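(* Let $(M,E^* )$ be a constrained matrix, where $M$ is an $n\times m$ binary matrix and $E^*$ is a set of $0$-entries of $M$, and let $M_e$ be its extended matrix with associated red-black graph $G_{RB}$. Then $(M,E^* )$ admits a persistent perfect phylogeny consistent with $E^*$ if and only if there exists a successful c-reduction of $G_{RB}$.
   Context: Rows of $M$ are species $s_1,\dots,s_n$ and columns are characters $c_1,\dots,c_m$; $M[i,j]=1$ means species $s_i$ has character $c_j$. $E^*=\{(i_1,j_1),\dots,(i_k,j_k)\}$ is a set of pairs with $M[i,j]=0$. Persistent perfect phylogeny (p-pp) for $M$: a rooted tree $T$ such that (1) each node $x$ is labeled by a vector $l_x\in\{0,1\}^m$; (2) the root is labeled by the all-zero vector; (3) each edge is labeled by at least one character; (4) for each character $c_j$ there are at most two edges $e=(x,y)$, $e'=(u,v)$ (parent first) with $l_x[j]\neq l_y[j]$, $l_u[j]\neq l_v[j]$; if there are two, they lie on a common root-to-leaf path, and if $e$ is closer to the root then $l_x[j]=l_v[j]=0$, $l_y[j]=l_u[j]=1$, with $e$ labeled $c_j^+$ (gain) and $e'$ labeled $c_j^-$ (loss); (5) each row $r$ of $M$ labels exactly one node $x$ of $T$, and $l_x=r$. A p-pp $T$ is consistent with $E^*$ if for every $(i,j)\in E^*$, no edge on the path from the root to the node labeled by row $s_i$ changes the state of $c_j$ (i.e. $c_j$ is not gained and then lost in $s_i$). Extended matrix $M_e$: the $n\times 2m$ matrix over $\{0,1,?\}$ obtained by replacing each column $c$ by a pair of conjugate columns $(c^+,c^-)$, where for each species $s$: if $M[s,c]=1$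 then $(M_e[s,c^+],M_e[s,c^-])=(1,0)$; if $M[s,c]=0$ and $(s,c)\notin E^*$ then it is $(?,?)$; if $(s,c)\in E^*$ then it is $(0,0)$. The matrix $M_e$ is progressively completed by the operations below (each $(?,?)$ pair being set to $(0,0)$ or $(1,1)$). Red-black graph: a graph whose vertices are the species and the characters (one vertex $c$ per conjugate pair). Initially $G_{RB}$ has a black edge $(s,c)$ for each $s,c$ with $M_e[s,c^+]=1$, $M_e[s,c^-]=0$, no red edges, and every character is in state \emph{inactive}. For a character $c$, let $\mathcal{C}(c)$ be the connected component of the current graph containing $c$. Realization of $c^+$: possible only if $c$ is inactive and no species $s\in\mathcal{C}(c)$ has $M_e[s,c^+]=M_e[s,c^-]=0$. Its effect: (a) for every species $s\notin\mathcal{C}(c)$ set $M_e[s,c^+]=M_e[s,c^-]=0$; (b) for every species $s\in\mathcal{C}(c)$ not adjacent to $c$, add a red edge $(c,s)$ and set $M_e[s,c^+]=M_e[s,c^-]=1$; (c) delete all black edges incident to $c$ and make $c$ \emph{active}. Realization of $c^-$: possible only if $c$ is active and $c$ is joined by red edges to all species of $\mathcal{C}(c)$. Its effect: delete all those red edges and make $c$ \emph{free}. A successful c-reduction of $G_{RB}$ is a sequence $R$ of signed characters ($c^+$ or $c^-$) in which every character $c$ appears (as $c^+$), every $c^-$ appearing in $R$ appears after $c^+$, every realization in $R$ performed in order starting from the initial graph is possible, and the resulting graph has no edges. *)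

theory Defs
  imports "Jordan_Normal_Form.Matrix" "Graph_Theory.Pair_Digraph"
begin

text \<open>Species and characters are numbered from 0: species \<open>i\<close> is row \<open>i\<close> of the matrix and
  character \<open>j\<close> is column \<open>j\<close>. The signed characters \<open>c\<^sup>+\<close> and \<open>c\<^sup>-\<close> are written
  \<open>Gain c\<close> and \<open>Loss c\<close>.\<close>

datatype signed_char = Gain (char_of: nat) | Loss (char_of: nat)

definition constrained_matrix :: "nat \<Rightarrow> nat \<Rightarrow> nat mat \<Rightarrow> (nat \<times> nat) set \<Rightarrow> bool" where
  "constrained_matrix n m M E \<longleftrightarrow>
     M \<in> carrier_mat n m \<and> elements_mat M \<subseteq> {0, 1} \<and>
     E \<subseteq> {(i, j). i < n \<and> j < m \<and> M $$ (i, j) = 0}"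


section \<open>Persistent perfect phylogenies\<close>

text \<open>Arcs of a rooted tree point away from the root.\<close>

definition rooted_tree :: "'v pair_pre_digraph \<Rightarrow> 'v \<Rightarrow> bool" where
  "rooted_tree T r \<longleftrightarrow>
     pair_fin_digraph T \<and> r \<in> pverts T \<and>
     (\<forall>v \<in> pverts T. \<exists>!p. pre_digraph.awalk T r p v)"

definition leaf :: "'v pair_pre_digraph \<Rightarrow> 'v \<Rightarrow> bool" where
  "leaf T z \<longleftrightarrow> z \<in> pverts T \<and> (\<forall>w. (z, w) \<notin> parcs T)"

definition on_common_root_leaf_path ::
    "'v pair_pre_digraph \<Rightarrow> 'v \<Rightarrow> 'v \<times> 'v \<Rightarrow> 'v \<times> 'v \<Rightarrow> bool" where
  "on_common_root_leaf_path T r e e' \<longleftrightarrow>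
     (\<exists>z p. leaf T z \<and> pre_digraph.awalk T r p z \<and> e \<in> set p \<and> e' \<in> set p)"

definition closer_to_root ::
    "'v pair_pre_digraph \<Rightarrow> 'v \<Rightarrow> 'v \<times> 'v \<Rightarrow> 'v \<times> 'v \<Rightarrow> bool" where
  "closer_to_root T r e e' \<longleftrightarrow>
     (\<exists>z p1 p2 p3. pre_digraph.awalk T r (p1 @ e # p2 @ e' # p3) z)"

definition changes :: "('v \<Rightarrow> nat vec) \<Rightarrow> nat \<Rightarrow> 'v \<times> 'v \<Rightarrow> bool" where
  "changes l j e \<longleftrightarrow> l (fst e) $ j \<noteq> l (snd e) $ j"

text \<open>The label of an edge consists of the signed characters whose state changes along it.\<close>

definition edge_label :: "nat \<Rightarrow> ('v \<Rightarrow> nat vec) \<Rightarrow> 'v \<times> 'v \<Rightarrow> signed_char set" where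
  "edge_label m l e =
     {Gain j | j. j < m \<and> l (fst e) $ j = 0 \<and> l (snd e) $ j = 1} \<union>
     {Loss j | j. j < m \<and> l (fst e) $ j = 1 \<and> l (snd e) $ j = 0}"

text \<open>\<open>l\<close> gives the vectors labelling the nodes, and \<open>\<rho> i\<close> is the node labelled by row \<open>i\<close>.
  Nodes not labelled by a row are allowed, also if they carry the same vector as some row, and
  identical rows may label the same node.\<close>

definition persistent_phylogeny ::
    "nat mat \<Rightarrow> 'v pair_pre_digraph \<Rightarrow> 'v \<Rightarrow> ('v \<Rightarrow> nat vec) \<Rightarrow> (nat \<Rightarrow> 'v) \<Rightarrow> bool" where
  "persistent_phylogeny M T r l \<rho> \<longleftrightarrow>
     rooted_tree T r \<and>
     (\<forall>x \<in> pverts T. l x \<in> carrier_vec (dim_col M) \<and> (\<forall>j < dim_col M. l x $ j \<in> {0, 1})) \<and>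
     l r = 0\<^sub>v (dim_col M) \<and>
     (\<forall>e \<in> parcs T. edge_label (dim_col M) l e \<noteq> {}) \<and>
     (\<forall>j < dim_col M.
        card {e \<in> parcs T. changes l j e} \<le> 2 \<and>
        (\<forall>e \<in> parcs T. \<forall>e' \<in> parcs T. e \<noteq> e' \<and> changes l j e \<and> changes l j e' \<longrightarrow>
           on_common_root_leaf_path T r e e' \<and>
           (closer_to_root T r e e' \<longrightarrow>
              Gain j \<in> edge_label (dim_col M) l e \<and> Loss j \<in> edge_label (dim_col M) l e'))) \<and>
     (\<forall>i < dim_row M. \<rho> i \<in> pverts T \<and> l (\<rho> i) = row M i)"

definition consistent ::
    "(nat \<times> nat) set \<Rightarrow> 'v pair_pre_digraph \<Rightarrow> 'v \<Rightarrow> ('v \<Rightarrow> nat vec) \<Rightarrow> (nat \<Rightarrow> 'v) \<Rightarrow> bool" where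
  "consistent E T r l \<rho> \<longleftrightarrow>
     (\<forall>(i, j) \<in> E. \<forall>p. pre_digraph.awalk T r p (\<rho> i) \<longrightarrow> (\<forall>e \<in> set p. \<not> changes l j e))"

text \<open>A finite tree has, up to renaming, nodes in \<open>nat\<close>.\<close>

definition admits_persistent_phylogeny :: "nat mat \<Rightarrow> (nat \<times> nat) set \<Rightarrow> bool" where
  "admits_persistent_phylogeny M E \<longleftrightarrow>
     (\<exists>(T :: nat pair_pre_digraph) r l \<rho>. persistent_phylogeny M T r l \<rho> \<and> consistent E T r l \<rho>)"


section \<open>The extended matrix\<close>

datatype entry = Zero | One | Unknown

text \<open>The conjugate columns of character \<open>c\<close> are the columns \<open>2 * c\<close> and \<open>2 * c + 1\<close>.\<close>

fun column :: "signed_char \<Rightarrow> nat" where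
  "column (Gain c) = 2 * c"
| "column (Loss c) = 2 * c + 1"

definition extended_matrix :: "nat mat \<Rightarrow> (nat \<times> nat) set \<Rightarrow> entry mat" where
  "extended_matrix M E = mat (dim_row M) (2 * dim_col M) (\<lambda>(s, k).
     if M $$ (s, k div 2) = 1 then (if even k then One else Zero)
     else if (s, k div 2) \<in> E then Zero
     else Unknown)"

text \<open>\<open>set_pair A c f\<close> sets both conjugate entries of \<open>c\<close> to \<open>v\<close> in each row \<open>s\<close> with
  \<open>f s = Some v\<close>.\<close>

definition set_pair :: "entry mat \<Rightarrow> nat \<Rightarrow> (nat \<Rightarrow> entry option) \<Rightarrow> entry mat" where
  "set_pair A c f = mat (dim_row A) (dim_col A) (\<lambda>(s, k).
     if k = column (Gain c) \<or> k = column (Loss c)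
     then (case f s of Some v \<Rightarrow> v | None \<Rightarrow> A $$ (s, k))
     else A $$ (s, k))"


section \<open>Red-black graphs and c-reductions\<close>

datatype status = Inactive | Active | Free

datatype vertex = Species nat | Character nat

text \<open>Black and red edges are stored as pairs (species, character).\<close>

record red_black =
  ext_mat :: "entry mat"
  black :: "(nat \<times> nat) set"
  red :: "(nat \<times> nat) set"
  status_of :: "nat \<Rightarrow> status"

definition initial_red_black :: "entry mat \<Rightarrow> red_black" where
  "initial_red_black A =
     \<lparr> ext_mat = A,
       black = {(s, c). s < dim_row A \<and> c < dim_col A div 2 \<and>
                        A $$ (s, column (Gain c)) = One \<and> A $$ (s, column (Loss c)) = Zero},
       red = {},
       status_of = (\<lambda>c. Inactive) \<rparr>"

text \<open>The underlying undirected graph, as a symmetric digraph.\<close>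

definition graph_of :: "red_black \<Rightarrow> vertex pair_pre_digraph" where
  "graph_of G =
     \<lparr> pverts = Species ` {..<dim_row (ext_mat G)} \<union> Character ` {..<dim_col (ext_mat G) div 2},
       parcs = {(Species s, Character c) | s c. (s, c) \<in> black G \<union> red G} \<union>
               {(Character c, Species s) | s c. (s, c) \<in> black G \<union> red G} \<rparr>"

definition component_species :: "red_black \<Rightarrow> nat \<Rightarrow> nat set" where
  "component_species G c = {s. Character c \<rightarrow>\<^sup>*\<^bsub>graph_of G\<^esub> Species s}"

fun possible :: "red_black \<Rightarrow> signed_char \<Rightarrow> bool" where
  "possible G (Gain c) \<longleftrightarrow>
     status_of G c = Inactive \<and>
     \<not> (\<exists>s \<in> component_species G c.
           ext_mat G $$ (s, column (Gain c)) = Zero \<and> ext_mat G $$ (s, column (Loss c)) = Zero)"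
| "possible G (Loss c) \<longleftrightarrow>
     status_of G c = Active \<and> (\<forall>s \<in> component_species G c. (s, c) \<in> red G)"

fun realize :: "red_black \<Rightarrow> signed_char \<Rightarrow> red_black" where
  "realize G (Gain c) =
     (let K = component_species G c; adj = {s. (s, c) \<in> black G \<union> red G} in
      \<lparr> ext_mat = set_pair (ext_mat G) c
          (\<lambda>s. if s \<notin> K then Some Zero else if s \<notin> adj then Some One else None),
        black = black G - {(s, c) | s. True},
        red = red G \<union> {(s, c) | s. s \<in> K \<and> s \<notin> adj},
        status_of = (status_of G)(c := Active) \<rparr>)"
| "realize G (Loss c) =
     G \<lparr> red := red G - {(s, c) | s. s \<in> component_species G c},
         status_of := (status_of G)(c := Free) \<rparr>"

fun all_possible :: "red_black \<Rightarrow> signed_char list \<Rightarrow> bool" where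
  "all_possible G [] \<longleftrightarrow> True"
| "all_possible G (x # R) \<longleftrightarrow> possible G x \<and> all_possible (realize G x) R"

definition successful_c_reduction :: "red_black \<Rightarrow> signed_char list \<Rightarrow> bool" where
  "successful_c_reduction G R \<longleftrightarrow>
     char_of ` set R \<subseteq> {..<dim_col (ext_mat G) div 2} \<and>
     (\<forall>c < dim_col (ext_mat G) div 2. Gain c \<in> set R) \<and>
     (\<forall>k < length R. \<forall>c. R ! k = Loss c \<longrightarrow> (\<exists>i < k. R ! i = Gain c)) \<and>
     all_possible G R \<and>
     black (foldl realize G R) = {} \<and> red (foldl realize G R) = {}"

end

theory Submission
  imports Defs
begin

text \<open>Both sides are equivalent to the existence of a laminar family of species sets \<open>B c\<^sup>+\<close>
  and \<open>B c\<^sup>-\<close> with \<open>B c\<^sup>- \<subseteq> B c\<^sup>+\<close>, whose differences \<open>B c\<^sup>+ - B c\<^sup>-\<close> are the columns of the matrix.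

  In a phylogeny, \<open>B k\<close> is the set of species below the edge labelled \<open>k\<close>; conversely the Hasse
  diagram of a laminar family is a tree.

  In a reduction, \<open>B k\<close> is the set of species in the component of the character when \<open>k\<close> is
  realized. The components only get finer during a reduction, so these sets are laminar. Conversely,
  realizing the signed characters by decreasing size of \<open>B k\<close> succeeds: every edge of the current
  graph joins a character to a species in the set of its next signed character, so by
  laminarity the component of the character realized next stays inside its own set.\<close>

definition laminar_extension ::
    "nat \<Rightarrow> nat \<Rightarrow> nat mat \<Rightarrow> (nat \<times> nat) set \<Rightarrow> (signed_char \<Rightarrow> nat set) \<Rightarrow> bool" where
  "laminar_extension n m M E B \<longleftrightarrow>
     (\<forall>c < m. B (Loss c) \<subseteq> B (Gain c) \<and> B (Gain c) \<subseteq> {..<n}) \<and>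
     (\<forall>s < n. \<forall>c < m. M $$ (s, c) = 1 \<longleftrightarrow> s \<in> B (Gain c) - B (Loss c)) \<and>
     (\<forall>(s, c) \<in> E. s \<notin> B (Gain c)) \<and>
     (\<forall>k k'. char_of k < m \<and> char_of k' < m \<longrightarrow> B k \<subseteq> B k' \<or> B k' \<subseteq> B k \<or> B k \<inter> B k' = {})"

section \<open>From phylogenies to laminar families\<close>

lemma change_on_walk:
  assumes "pcas u p v" "l u $ j = a" "l v $ j \<noteq> a"
  shows "\<exists>e \<in> set p. l (fst e) $ j = a \<and> l (snd e) $ j \<noteq> a"
  using assms
proof (induction p arbitrary: u)
  case (Cons e p)
  then show ?case by (cases "l (snd e) $ j = a") auto
qed simp

lemma laminar_extension_if_phylogeny:
  assumes cm: "constrained_matrix n m M E"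
    and P: "persistent_phylogeny M T r l \<rho>" and C: "consistent E T r l \<rho>"
  shows "\<exists>B. laminar_extension n m M E B"
proof -
  have dims: "dim_row M = n" "dim_col M = m"
    using cm by (auto simp: constrained_matrix_def)
  interpret pair_fin_digraph T
    using P by (simp add: persistent_phylogeny_def rooted_tree_def)
  have "\<exists>!p. awalk r p v" if "v \<in> pverts T" for v
    using P that by (simp add: persistent_phylogeny_def rooted_tree_def)
  then have uniq: "p = q" if "awalk r p v" "awalk r q v" for p q v
    using that awalk_last_in_verts by blast
  have zero_one: "l x $ j = 0 \<or> l x $ j = 1" if "x \<in> pverts T" "j < m" for x j
    using P that dims by (auto simp: persistent_phylogeny_def)
  have root: "l r $ j = 0" if "j < m" for j
    using P that dims by (auto simp: persistent_phylogeny_def)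
  have leaves: "\<rho> i \<in> pverts T \<and> (\<forall>j < m. l (\<rho> i) $ j = M $$ (i, j))" if "i < n" for i
    using P that dims by (auto simp: persistent_phylogeny_def)
  have changing: "on_common_root_leaf_path T r e e' \<and>
      (closer_to_root T r e e' \<longrightarrow> Gain j \<in> edge_label m l e \<and> Loss j \<in> edge_label m l e')"
    if "e \<in> parcs T" "e' \<in> parcs T" "e \<noteq> e'" "changes l j e" "changes l j e'" "j < m" for e e' j
    using P that dims unfolding persistent_phylogeny_def by auto
  have label_changes: "changes l (char_of k) e" if "k \<in> edge_label m l e" for k e
    using that by (auto simp: edge_label_def changes_def)
  have exclusive: "\<not> (Gain j \<in> edge_label m l e \<and> Loss j \<in> edge_label m l e)" for j e
    by (auto simp: edge_label_def)
  have closer: "\<exists>p1 p2 p3. p = p1 @ e # p2 @ e' # p3 \<or> p = p1 @ e' # p2 @ e # p3"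
    if e: "e \<in> set p" and e': "e' \<in> set p" "e \<noteq> e'" for p and e e' :: "'a \<times> 'a"
  proof -
    obtain q1 q2 where q: "p = q1 @ e # q2"
      using split_list[OF \<open>e \<in> set p\<close>] by auto
    then consider "e' \<in> set q1" | "e' \<in> set q2" using e' by auto
    then show ?thesis
    proof cases
      case 1
      then obtain q3 q4 where "q1 = q3 @ e' # q4" by (meson split_list)
      then show ?thesis using q by force
    next
      case 2
      then obtain q3 q4 where "q2 = q3 @ e' # q4" by (meson split_list)
      then show ?thesis using q by force
    qed
  qed
  have label_unique: "e = e'"
    if k: "k \<in> edge_label m l e" "k \<in> edge_label m l e'" and e: "e \<in> parcs T" "e' \<in> parcs T"
    for k e e'
  proof (rule ccontr)
    assume "e \<noteq> e'"
    have j: "char_of k < m" using k by (auto simp: edge_label_def)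
    note ch = changing[OF _ _ _ label_changes label_changes, OF _ _ _ _ _ j]
    have "on_common_root_leaf_path T r e e'"
      using ch[OF e \<open>e \<noteq> e'\<close> k] by simp
    then obtain z p where "awalk r p z" "e \<in> set p" "e' \<in> set p"
      by (auto simp: on_common_root_leaf_path_def)
    then have "closer_to_root T r e e' \<or> closer_to_root T r e' e"
      using closer[of e p e'] \<open>e \<noteq> e'\<close> unfolding closer_to_root_def by blast
    then have "(Gain (char_of k) \<in> edge_label m l e \<and> Loss (char_of k) \<in> edge_label m l e') \<or>
        (Gain (char_of k) \<in> edge_label m l e' \<and> Loss (char_of k) \<in> edge_label m l e)"
      using ch[OF e \<open>e \<noteq> e'\<close> k] ch[OF e(2,1) \<open>e \<noteq> e'\<close>[symmetric] k(2,1)] by blast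
    then show False
      using k exclusive[of "char_of k" e] exclusive[of "char_of k" e'] by (cases k) auto
  qed
  have gain_on_walk: "\<exists>e \<in> set p. Gain j \<in> edge_label m l e"
    if walk: "awalk u p v" and ends: "l u $ j = 0" "l v $ j = 1" and j: "j < m" for u p v j
  proof -
    obtain e where e: "e \<in> set p" "l (fst e) $ j = 0" "l (snd e) $ j \<noteq> 0"
      using change_on_walk[of u p v l j 0] walk ends by (auto simp: awalk_def)
    then have "snd e \<in> pverts T"
      using walk awalk_def arc_snd_in_verts by blast
    then show ?thesis
      using e(1,2,3) zero_one[of "snd e" j] j by (auto simp: edge_label_def intro!: bexI[of _ e])
  qed
  have loss_on_walk: "\<exists>e \<in> set p. Loss j \<in> edge_label m l e"
    if walk: "awalk u p v" and ends: "l u $ j = 1" "l v $ j = 0" and j: "j < m" for u p v j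
  proof -
    obtain e where e: "e \<in> set p" "l (fst e) $ j = 1" "l (snd e) $ j \<noteq> 1"
      using change_on_walk[of u p v l j 1] walk ends by (auto simp: awalk_def)
    then have "snd e \<in> pverts T"
      using walk awalk_def arc_snd_in_verts by blast
    then show ?thesis
      using e(1,2,3) zero_one[of "snd e" j] j by (auto simp: edge_label_def intro!: bexI[of _ e])
  qed
  define B where "B k = {i. i < n \<and> (\<exists>p. awalk r p (\<rho> i) \<and> (\<exists>e \<in> set p. k \<in> edge_label m l e))}" for k
  have arcs: "e \<in> parcs T" if "awalk u p v" "e \<in> set p" for u p v e
    using that awalk_def by auto
  have nested: "B k' \<subseteq> B k"
    if w: "awalk r (p1 @ e # p2 @ e' # p3) z" and k: "k \<in> edge_label m l e" "k' \<in> edge_label m l e'"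
    for k k' p1 e p2 e' p3 z
  proof
    fix t
    assume "t \<in> B k'"
    then obtain q f where q: "t < n" "awalk r q (\<rho> t)" "f \<in> set q" "k' \<in> edge_label m l f"
      by (auto simp: B_def)
    have "f = e'"
      using label_unique[OF q(4) k(2)] arcs[OF q(2,3)] arcs[OF w] by auto
    then obtain q1 q2 where q12: "q = q1 @ e' # q2"
      using q(3) by (meson split_list)
    have "awalk r q1 (fst e')"
      using q(2) unfolding q12 by (auto simp: awalk_simps)
    moreover have "awalk r (p1 @ e # p2) (fst e')"
      using w awalk_append_iff[of r "p1 @ e # p2" "e' # p3" z] by (auto simp: awalk_Cons_iff)
    ultimately have "q1 = p1 @ e # p2" by (rule uniq)
    then have "e \<in> set q" using q12 by simp
    then show "t \<in> B k"
      using q(1,2) k(1) by (auto simp: B_def)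
  qed
  have nested_same: "B k' \<subseteq> B k"
    if k: "k \<in> edge_label m l e" "k' \<in> edge_label m l e" and e: "e \<in> parcs T" for k k' e
  proof
    fix t
    assume "t \<in> B k'"
    then obtain q f where q: "t < n" "awalk r q (\<rho> t)" "f \<in> set q" "k' \<in> edge_label m l f"
      by (auto simp: B_def)
    have "f = e" using label_unique[OF q(4) k(2)] arcs[OF q(2,3)] e by simp
    then show "t \<in> B k" unfolding B_def using q k(1) by blast
  qed
  have "laminar_extension n m M E B"
    unfolding laminar_extension_def
  proof (intro conjI allI impI)
    fix c assume c: "c < m"
    show "B (Gain c) \<subseteq> {..<n}" by (auto simp: B_def)
    show "B (Loss c) \<subseteq> B (Gain c)"
    proof
      fix i
      assume "i \<in> B (Loss c)"
      then obtain p e where p: "i < n" "awalk r p (\<rho> i)" "e \<in> set p" "Loss c \<in> edge_label m l e"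
        by (auto simp: B_def)
      obtain p1 p2 where p12: "p = p1 @ e # p2"
        using p(3) by (meson split_list)
      have "awalk r p1 (fst e)"
        using p(2) unfolding p12 by (auto simp: awalk_simps)
      moreover have "l (fst e) $ c = 1"
        using p(4) by (auto simp: edge_label_def)
      ultimately obtain f where "f \<in> set p1" "Gain c \<in> edge_label m l f"
        using gain_on_walk root c by blast
      moreover have "set p1 \<subseteq> set p" using p12 by auto
      ultimately show "i \<in> B (Gain c)"
        unfolding B_def using p(1,2) by blast
    qed
  next
    fix i c assume i: "i < n" and c: "c < m"
    have l_row: "l (\<rho> i) $ c = M $$ (i, c)" and node: "\<rho> i \<in> pverts T"
      using leaves i c by auto
    obtain p where p: "awalk r p (\<rho> i)"
      using \<open>\<And>v. v \<in> pverts T \<Longrightarrow> \<exists>!p. awalk r p v\<close>[OF node] by blast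
    show "M $$ (i, c) = 1 \<longleftrightarrow> i \<in> B (Gain c) - B (Loss c)"
    proof
      assume one: "M $$ (i, c) = 1"
      then have "\<exists>e \<in> set p. Gain c \<in> edge_label m l e"
        using gain_on_walk[OF p] root l_row c by simp
      then have "i \<in> B (Gain c)"
        unfolding B_def using i p by blast
      moreover have "i \<notin> B (Loss c)"
      proof
        assume "i \<in> B (Loss c)"
        then obtain e where e: "e \<in> set p" "Loss c \<in> edge_label m l e"
          unfolding B_def using uniq[OF p] by blast
        obtain p1 p2 where p12: "p = p1 @ e # p2"
          using e(1) by (meson split_list)
        have "awalk (snd e) p2 (\<rho> i)"
          using p unfolding p12 by (auto simp: awalk_simps)
        moreover have "l (snd e) $ c = 0"
          using e(2) by (auto simp: edge_label_def)
        ultimately obtain f where f: "f \<in> set p2" "Gain c \<in> edge_label m l f"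
          using gain_on_walk one l_row c by metis
        obtain p3 p4 where "p2 = p3 @ f # p4"
          using f(1) by (meson split_list)
        then have "closer_to_root T r e f"
          using p p12 unfolding closer_to_root_def by blast
        moreover have "e \<noteq> f"
          using e f exclusive by blast
        moreover have "e \<in> parcs T" "f \<in> parcs T"
          using arcs[OF p] p12 f by auto
        ultimately have "Gain c \<in> edge_label m l e"
          using changing[of e f c] label_changes e f c by (metis signed_char.sel)
        then show False
          using e exclusive by blast
      qed
      ultimately show "i \<in> B (Gain c) - B (Loss c)" by simp
    next
      assume diff: "i \<in> B (Gain c) - B (Loss c)"
      then obtain e where e: "e \<in> set p" "Gain c \<in> edge_label m l e"
        unfolding B_def using uniq[OF p] by blast
      obtain p1 p2 where p12: "p = p1 @ e # p2"
        using e(1) by (meson split_list)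
      have "awalk (snd e) p2 (\<rho> i)"
        using p unfolding p12 by (auto simp: awalk_simps)
      moreover have "l (snd e) $ c = 1"
        using e(2) by (auto simp: edge_label_def)
      moreover have "\<not> (\<exists>f \<in> set p2. Loss c \<in> edge_label m l f)"
      proof
        assume "\<exists>f \<in> set p2. Loss c \<in> edge_label m l f"
        then have "\<exists>f \<in> set p. Loss c \<in> edge_label m l f" using p12 by auto
        then have "i \<in> B (Loss c)" unfolding B_def using i p by blast
        then show False using diff by blast
      qed
      ultimately have "l (\<rho> i) $ c \<noteq> 0"
        using loss_on_walk c by blast
      then show "M $$ (i, c) = 1"
        using zero_one[OF node c] l_row by simp
    qed
  next
    show "\<forall>(s, c) \<in> E. s \<notin> B (Gain c)"
    proof (intro ballI, clarify)
      fix s c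
      assume sc: "(s, c) \<in> E" "s \<in> B (Gain c)"
      then obtain p e where "awalk r p (\<rho> s)" "e \<in> set p" "Gain c \<in> edge_label m l e"
        unfolding B_def by blast
      moreover from this(3) have "changes l c e" using label_changes by fastforce
      ultimately show False using C sc(1) unfolding consistent_def by blast
    qed
  next
    fix k k'
    show "B k \<subseteq> B k' \<or> B k' \<subseteq> B k \<or> B k \<inter> B k' = {}"
    proof (cases "B k \<inter> B k' = {}")
      case False
      then obtain i where "i \<in> B k" "i \<in> B k'" by auto
      then obtain p e e' where p: "awalk r p (\<rho> i)"
        and e: "e \<in> set p" "e' \<in> set p" "k \<in> edge_label m l e" "k' \<in> edge_label m l e'"
        using uniq unfolding B_def by blast
      show ?thesis
      proof (cases "e = e'")
        case True
        then have "B k = B k'"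
          using nested_same[OF _ _ arcs[OF p e(1)]] e(3,4) by blast
        then show ?thesis by simp
      next
        case False
        then show ?thesis
          using closer[OF e(1,2)] nested p e(3,4) by blast
      qed
    qed simp
  qed
  then show ?thesis by blast
qed

section \<open>From laminar families to phylogenies\<close>

locale laminar_family =
  fixes V :: "'v set" and D :: "'v \<Rightarrow> 'a set" and r :: 'v
  assumes finite_V: "finite V" and inj: "inj_on D V" and root_in_V: "r \<in> V"
    and nonempty: "v \<in> V \<Longrightarrow> D v \<noteq> {}" and finite_root: "finite (D r)"
    and root_top: "v \<in> V \<Longrightarrow> D v \<subseteq> D r"
    and laminar: "u \<in> V \<Longrightarrow> v \<in> V \<Longrightarrow> D u \<subseteq> D v \<or> D v \<subseteq> D u \<or> D u \<inter> D v = {}"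
begin

lemma finite_D: "v \<in> V \<Longrightarrow> finite (D v)"
  using root_top finite_root finite_subset by blast

definition tree :: "'v pair_pre_digraph" where
  "tree = \<lparr> pverts = V,
     parcs = {(u, v). u \<in> V \<and> v \<in> V \<and> D v \<subset> D u \<and> (\<forall>w \<in> V. D v \<subset> D w \<longrightarrow> D u \<subseteq> D w)} \<rparr>"

lemma arcD:
  assumes "e \<in> parcs tree"
  shows "fst e \<in> V" "snd e \<in> V" "D (snd e) \<subset> D (fst e)"
    and "w \<in> V \<Longrightarrow> D (snd e) \<subset> D w \<Longrightarrow> D (fst e) \<subseteq> D w"
proof -
  obtain u v where "e = (u, v)" by fastforce
  then show "fst e \<in> V" "snd e \<in> V" "D (snd e) \<subset> D (fst e)"
    and "w \<in> V \<Longrightarrow> D (snd e) \<subset> D w \<Longrightarrow> D (fst e) \<subseteq> D w"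
    using assms by (simp_all add: tree_def)
qed

lemma arc_unique:
  assumes "e \<in> parcs tree" "e' \<in> parcs tree" "snd e = snd e'"
  shows "e = e'"
proof -
  have "D (fst e) = D (fst e')"
    using assms arcD by (metis subset_antisym)
  then have "fst e = fst e'"
    using inj arcD(1) assms by (meson inj_onD)
  then show ?thesis using assms(3) by (simp add: prod_eq_iff)
qed

lemma least_of_chain:
  assumes "S \<subseteq> V" "S \<noteq> {}" "A \<noteq> {}" "\<And>v. v \<in> S \<Longrightarrow> A \<subseteq> D v"
  obtains u where "u \<in> S" "\<And>v. v \<in> S \<Longrightarrow> D u \<subseteq> D v"
proof -
  have "finite S" using assms finite_V finite_subset by blast
  then obtain u where u: "u \<in> S" "\<And>v. v \<in> S \<Longrightarrow> card (D u) \<le> card (D v)"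
    using ex_min_if_finite[of "(\<lambda>v. card (D v)) ` S"] assms(2) by (auto simp: not_less)
  have "D u \<subseteq> D v" if "v \<in> S" for v
  proof -
    have "D u \<inter> D v \<noteq> {}" using assms(3,4) u that by blast
    then have "D u \<subseteq> D v \<or> D v \<subseteq> D u" using laminar u that assms(1) by blast
    then show ?thesis
      using u(2)[OF that] finite_D u(1) assms(1) by (metis card_seteq subsetD subset_refl)
  qed
  then show ?thesis using that u by blast
qed

lemma parent_exists:
  assumes "v \<in> V" "v \<noteq> r"
  obtains u where "(u, v) \<in> parcs tree"
proof -
  have "D v \<subset> D r"
    using assms root_top inj root_in_V by (metis inj_onD psubsetI)
  then have "{w \<in> V. D v \<subset> D w} \<noteq> {}" using root_in_V by blast
  then obtain u where "u \<in> {w \<in> V. D v \<subset> D w}" "\<And>w. w \<in> {w \<in> V. D v \<subset> D w} \<Longrightarrow> D u \<subseteq> D w"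
    using least_of_chain[of "{w \<in> V. D v \<subset> D w}" "D v"] nonempty[OF assms(1)] by blast
  then have "(u, v) \<in> parcs tree" using assms by (simp add: tree_def)
  then show ?thesis by (rule that)
qed

sublocale tree: pair_fin_digraph tree
proof
  show "finite (parcs tree)"
    by (rule finite_subset[of _ "V \<times> V"]) (auto simp: tree_def finite_V)
qed (auto simp: tree_def finite_V)

lemma walk_descends:
  assumes "tree.awalk u p v"
  shows "D v \<subseteq> D u" and "p \<noteq> [] \<Longrightarrow> D v \<subset> D u"
proof -
  have "D v \<subseteq> D u \<and> (p \<noteq> [] \<longrightarrow> D v \<subset> D u)"
    using assms
  proof (induction p arbitrary: u)
    case (Cons e p)
    then have "e \<in> parcs tree" "u = fst e" "D v \<subseteq> D (snd e)"
      by (auto simp: tree.awalk_Cons_iff)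
    then show ?case using arcD(3)[of e] by blast
  qed (simp add: tree.awalk_Nil_iff)
  then show "D v \<subseteq> D u" "p \<noteq> [] \<Longrightarrow> D v \<subset> D u" by auto
qed

lemma walk_exists:
  assumes "u \<in> V" "v \<in> V" "D v \<subseteq> D u"
  shows "\<exists>p. tree.awalk u p v"
  using assms(2,3)
proof (induction "card (D r) - card (D v)" arbitrary: v rule: less_induct)
  case less
  show ?case
  proof (cases "u = v")
    case True
    moreover have "v \<in> pverts tree" using less.prems by (simp add: tree_def)
    ultimately show ?thesis using tree.awalk_Nil_iff by blast
  next
    case False
    then have sub: "D v \<subset> D u" using inj less.prems assms(1) by (metis inj_onD psubsetI)
    then have "v \<noteq> r" using root_top assms(1) by auto
    then obtain w where w: "(w, v) \<in> parcs tree" using parent_exists less.prems by blast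
    have wV: "w \<in> V" "D v \<subset> D w" "D w \<subseteq> D u" using arcD[OF w] sub assms(1) by auto
    have "card (D v) < card (D w)" "card (D w) \<le> card (D r)"
      by (rule psubset_card_mono[OF finite_D[OF wV(1)] wV(2)],
          rule card_mono[OF finite_root root_top[OF wV(1)]])
    then have "card (D r) - card (D w) < card (D r) - card (D v)" by linarith
    then obtain p where "tree.awalk u p w" using less.hyps[of w] wV(1,3) by blast
    moreover have "tree.awalk w [(w, v)] v"
      using w less.prems by (simp add: tree.awalk_simps) (simp add: tree_def)
    ultimately show ?thesis using tree.awalk_appendI by blast
  qed
qed

lemma walk_unique:
  assumes "tree.awalk u p v" "tree.awalk u q v"
  shows "p = q"
  using assms
proof (induction p arbitrary: v q rule: rev_induct)
  case Nil
  then have "u = v" by (simp add: tree.awalk_Nil_iff)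
  then show ?case using walk_descends(2)[OF Nil(2)] by auto
next
  case (snoc e p)
  have "q \<noteq> []"
    using walk_descends(2)[OF snoc.prems(1)] snoc.prems(2) by (auto simp: tree.awalk_Nil_iff)
  then obtain q' e' where q: "q = q' @ [e']" by (meson rev_exhaust)
  have p_walk: "tree.awalk u p (fst e)" "e \<in> parcs tree" "snd e = v"
    using snoc.prems(1) by (auto simp: tree.awalk_simps)
  have q_walk: "tree.awalk u q' (fst e')" "e' \<in> parcs tree" "snd e' = v"
    using snoc.prems(2) unfolding q by (auto simp: tree.awalk_simps)
  have "e = e'" using arc_unique p_walk q_walk by simp
  then show ?case using snoc.IH p_walk q_walk q by simp
qed

lemma rooted_tree_tree: "rooted_tree tree r"
  unfolding rooted_tree_def
proof (intro conjI ballI)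
  show "pair_fin_digraph tree" by (rule tree.pair_fin_digraph)
  show "r \<in> pverts tree" using root_in_V by (simp add: tree_def)
  fix v
  assume "v \<in> pverts tree"
  then have "v \<in> V" by (simp add: tree_def)
  then show "\<exists>!p. tree.awalk r p v"
    using walk_exists[OF root_in_V] root_top walk_unique by blast
qed

lemma leaf_below:
  assumes "v \<in> V"
  obtains z where "leaf tree z" "D z \<subseteq> D v"
proof -
  let ?S = "{w \<in> V. D w \<subseteq> D v}"
  have "finite ?S" "?S \<noteq> {}" using assms finite_V by auto
  then obtain z where z: "z \<in> ?S" "\<And>w. w \<in> ?S \<Longrightarrow> card (D z) \<le> card (D w)"
    using ex_min_if_finite[of "(\<lambda>v. card (D v)) ` ?S"] by (auto simp: not_less)
  have "(z, w) \<notin> parcs tree" for w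
  proof
    assume "(z, w) \<in> parcs tree"
    then have "w \<in> V" "D w \<subset> D z" using arcD by fastforce+
    then have "card (D w) < card (D z)" "w \<in> ?S"
      using z(1) finite_D by (auto intro: psubset_card_mono)
    then show False using z(2) by fastforce
  qed
  moreover have "z \<in> pverts tree" using z(1) by (simp add: tree_def)
  ultimately have "leaf tree z" by (simp add: leaf_def)
  then show ?thesis using that z(1) by blast
qed

lemma on_common_path:
  assumes "e \<in> parcs tree" "e' \<in> parcs tree" "D (snd e') \<subset> D (snd e)"
  shows "on_common_root_leaf_path tree r e e'"
proof -
  obtain z where z: "leaf tree z" "D z \<subseteq> D (snd e')"
    using leaf_below arcD(2)[OF assms(2)] by blast
  have "z \<in> V" using z by (simp add: leaf_def tree_def)
  obtain p1 where p1: "tree.awalk r p1 (fst e)"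
    using walk_exists[OF root_in_V arcD(1)[OF assms(1)]] root_top arcD(1)[OF assms(1)] by auto
  obtain p2 where p2: "tree.awalk (snd e) p2 (fst e')"
    using walk_exists[OF arcD(2)[OF assms(1)] arcD(1)[OF assms(2)]
        arcD(4)[OF assms(2) arcD(2)[OF assms(1)] assms(3)]] by blast
  obtain p3 where p3: "tree.awalk (snd e') p3 z"
    using walk_exists[OF arcD(2)[OF assms(2)] \<open>z \<in> V\<close> z(2)] by blast
  have "tree.awalk (fst e) (e # p2) (fst e')" "tree.awalk (fst e') (e' # p3) z"
    using p2 p3 assms by (simp_all add: tree.awalk_Cons_iff)
  then have "tree.awalk r (p1 @ (e # p2) @ (e' # p3)) z"
    using p1 tree.awalk_appendI by blast
  then show ?thesis
    unfolding on_common_root_leaf_path_def using z(1)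
    by (intro exI[of _ z] exI[of _ "p1 @ (e # p2) @ (e' # p3)"]) simp
qed

lemma closer_descends:
  assumes "closer_to_root tree r e e'"
  shows "D (snd e') \<subset> D (snd e)"
proof -
  obtain z p1 p2 p3 where "tree.awalk r (p1 @ e # p2 @ e' # p3) z"
    using assms by (auto simp: closer_to_root_def)
  then have "tree.awalk (snd e) p2 (fst e')" "e' \<in> parcs tree"
    by (auto simp: tree.awalk_simps)
  then show ?thesis using walk_descends(1) arcD(3) by blast
qed

end

text \<open>A character gained and lost on the same edge would leave that edge without a label.\<close>

lemma laminar_extension_strict:
  assumes B: "laminar_extension n m M E B"
  obtains B' where "laminar_extension n m M E B'"
    and "\<And>c. c < m \<Longrightarrow> B' (Gain c) \<noteq> {} \<Longrightarrow> B' (Loss c) \<subset> B' (Gain c)"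
proof
  let ?B = "\<lambda>k. if B (Gain (char_of k)) = B (Loss (char_of k)) then {} else B k"
  show "laminar_extension n m M E ?B"
    using B unfolding laminar_extension_def by (auto split: if_splits)
  show "\<And>c. c < m \<Longrightarrow> ?B (Gain c) \<noteq> {} \<Longrightarrow> ?B (Loss c) \<subset> ?B (Gain c)"
    using B unfolding laminar_extension_def by (auto split: if_splits)
qed

lemma phylogeny_if_laminar_extension:
  assumes cm: "constrained_matrix n m M E" and "laminar_extension n m M E B0"
  shows "admits_persistent_phylogeny M E"
proof -
  obtain B where B: "laminar_extension n m M E B"
    and strict: "\<And>c. c < m \<Longrightarrow> B (Gain c) \<noteq> {} \<Longrightarrow> B (Loss c) \<subset> B (Gain c)"
    by (rule laminar_extension_strict[OF assms(2)]) (rule that)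
  have dims: "dim_row M = n" "dim_col M = m"
    using cm by (auto simp: constrained_matrix_def)
  have entries: "M $$ (i, j) = 0 \<or> M $$ (i, j) = 1" if "i < n" "j < m" for i j
  proof -
    have "M $$ (i, j) \<in> elements_mat M" using that dims by (force simp: elements_mat_def)
    then show ?thesis using cm by (auto simp: constrained_matrix_def)
  qed
  have B_Loss: "B (Loss c) \<subseteq> B (Gain c)" and B_Gain: "B (Gain c) \<subseteq> {..<n}" if "c < m" for c
    using B that unfolding laminar_extension_def by auto
  have B_sub: "B k \<subseteq> {..<n}" if "char_of k < m" for k
    using that B_Loss[of "char_of k"] B_Gain[of "char_of k"] by (cases k) auto
  have B_M: "M $$ (i, c) = 1 \<longleftrightarrow> i \<in> B (Gain c) - B (Loss c)" if "i < n" "c < m" for i c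
    using B that unfolding laminar_extension_def by blast
  \<comment> \<open>The root \<open>{..n}\<close> contains the non-species \<open>n\<close>, so that it lies strictly above every \<open>B k\<close>.\<close>
  define F where "F = insert {..n} (B ` {k. char_of k < m}) - {{}}"
  have "{k. char_of k < m} \<subseteq> Gain ` {..<m} \<union> Loss ` {..<m}"
  proof
    fix k assume "k \<in> {k. char_of k < m}"
    then show "k \<in> Gain ` {..<m} \<union> Loss ` {..<m}" by (cases k) auto
  qed
  then have "finite {k. char_of k < m}"
    by (rule finite_subset) simp
  then have "finite F" by (simp add: F_def)
  then obtain D where D: "bij_betw D {0..<card F} F"
    using ex_bij_betw_nat_finite by blast
  define V where "V = {0..<card F}"
  have D_V: "D ` V = F" and inj: "inj_on D V"
    using D by (auto simp: V_def bij_betw_def)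
  have "{..n} \<in> F" by (auto simp: F_def)
  then obtain r where r: "r \<in> V" "D r = {..n}" using D_V by (metis imageE)
  have B_node: "\<exists>w \<in> V. D w = B k" if "char_of k < m" "B k \<noteq> {}" for k
  proof -
    have "B k \<in> F" using that by (auto simp: F_def)
    then show ?thesis using D_V by (metis imageE)
  qed
  have node_B: "v = r \<or> (\<exists>k. char_of k < m \<and> D v = B k)" if "v \<in> V" for v
  proof -
    have "D v \<in> F" using D_V that by blast
    then consider "D v = D r" | k where "char_of k < m" "D v = B k"
      using r by (auto simp: F_def)
    then show ?thesis using inj r that by cases (auto dest: inj_onD)
  qed
  interpret laminar_family V D r
  proof
    fix u v assume u: "u \<in> V" and v: "v \<in> V"
    show D_le: "D v \<subseteq> D r"
      using node_B[OF v] B_sub r by fastforce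
    show "D v \<noteq> {}" using D_V v by (auto simp: F_def)
    have "D u \<subseteq> D r" using node_B[OF u] B_sub r by fastforce
    then show "D u \<subseteq> D v \<or> D v \<subseteq> D u \<or> D u \<inter> D v = {}"
      using node_B[OF u] node_B[OF v] D_le B unfolding laminar_extension_def by metis
  qed (use r inj in \<open>auto simp: V_def\<close>)
  define l where
    "l x = vec m (\<lambda>j. if D x \<subseteq> B (Gain j) \<and> \<not> D x \<subseteq> B (Loss j) then 1 else 0 :: nat)" for x
  have l_index: "l x $ j = (if D x \<subseteq> B (Gain j) \<and> \<not> D x \<subseteq> B (Loss j) then 1 else 0)"
    if "j < m" for x j
    using that by (simp add: l_def)
  have boundary: "D (snd e) = B k"
    if e: "e \<in> parcs tree" and k: "char_of k < m" "D (snd e) \<subseteq> B k" "\<not> D (fst e) \<subseteq> B k" for e k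
  proof -
    have "B k \<noteq> {}" using nonempty arcD(2)[OF e] k(2) by auto
    then obtain w where w: "w \<in> V" "D w = B k" using B_node k(1) by blast
    have "\<not> D (snd e) \<subset> D w" using arcD(4)[OF e w(1)] k(3) w(2) by auto
    then show ?thesis using k(2) w(2) by auto
  qed
  have changes_at: "D (snd e) = B (Gain j) \<or> D (snd e) = B (Loss j)"
    if e: "e \<in> parcs tree" "changes l j e" and j: "j < m" for e j
  proof (rule ccontr)
    assume not: "\<not> ?thesis"
    have "D (fst e) \<subseteq> B k \<longleftrightarrow> D (snd e) \<subseteq> B k" if "k \<in> {Gain j, Loss j}" for k
    proof -
      have "char_of k < m" "D (snd e) \<noteq> B k" using that not j by auto
      then show ?thesis using boundary[OF e(1), of k] arcD(3)[OF e(1)] by blast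
    qed
    then show False using e(2) j by (simp add: changes_def l_index)
  qed
  have gain: "Gain j \<in> edge_label m l e"
    if e: "e \<in> parcs tree" "D (snd e) = B (Gain j)" and j: "j < m" for e j
  proof -
    have "B (Loss j) \<subset> B (Gain j)"
      using strict[OF j] nonempty arcD(2)[OF e(1)] e(2) by metis
    then have "l (snd e) $ j = 1" using e(2) j by (auto simp: l_index)
    moreover have "l (fst e) $ j = 0" using e arcD(3)[OF e(1)] j by (auto simp: l_index)
    ultimately show ?thesis using j by (simp add: edge_label_def)
  qed
  have loss: "Loss j \<in> edge_label m l e"
    if e: "e \<in> parcs tree" "D (snd e) = B (Loss j)" and j: "j < m" for e j
  proof -
    have ne: "B (Loss j) \<noteq> {}" using nonempty arcD(2)[OF e(1)] e(2) by metis
    then have "B (Gain j) \<noteq> {}" using B_Loss[OF j] by auto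
    then obtain w where w: "w \<in> V" "D w = B (Gain j)" using B_node[of "Gain j"] j by auto
    have "D (fst e) \<subseteq> B (Gain j)"
      using arcD(4)[OF e(1) w(1)] strict[OF j] \<open>B (Gain j) \<noteq> {}\<close> e(2) w(2) by auto
    then have "l (fst e) $ j = 1" using e(2) arcD(3)[OF e(1)] j by (auto simp: l_index)
    moreover have "l (snd e) $ j = 0" using e j by (auto simp: l_index)
    ultimately show ?thesis using j by (simp add: edge_label_def)
  qed
  have D_eq: "e = e'" if "e \<in> parcs tree" "e' \<in> parcs tree" "D (snd e) = D (snd e')" for e e'
    using that arc_unique arcD(2) inj by (metis inj_onD)
  have "\<exists>x. x \<in> V \<and> i \<in> D x \<and> (\<forall>w \<in> V. i \<in> D w \<longrightarrow> D x \<subseteq> D w)" if "i < n" for i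
  proof -
    have "{w \<in> V. i \<in> D w} \<noteq> {}" using r that by auto
    then obtain x where "x \<in> {w \<in> V. i \<in> D w}" "\<And>w. w \<in> {w \<in> V. i \<in> D w} \<Longrightarrow> D x \<subseteq> D w"
      using least_of_chain[of "{w \<in> V. i \<in> D w}" "{i}"] by blast
    then show ?thesis by blast
  qed
  then obtain \<rho> where \<rho>: "\<And>i. i < n \<Longrightarrow> \<rho> i \<in> V \<and> i \<in> D (\<rho> i) \<and> (\<forall>w \<in> V. i \<in> D w \<longrightarrow> D (\<rho> i) \<subseteq> D w)"
    by metis
  have \<rho>_sub: "D (\<rho> i) \<subseteq> B k \<longleftrightarrow> i \<in> B k" if "i < n" "char_of k < m" for i k
    using \<rho>[OF that(1)] B_node[OF that(2)] by auto
  have "persistent_phylogeny M tree r l \<rho>"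
    unfolding persistent_phylogeny_def dims
  proof (intro conjI allI impI ballI)
    show "rooted_tree tree r" by (rule rooted_tree_tree)
    show "l r = 0\<^sub>v m"
    proof (rule eq_vecI)
      fix j assume "j < dim_vec (0\<^sub>v m :: nat vec)"
      then have j: "j < m" by simp
      then have "\<not> D r \<subseteq> B (Gain j)" using B_Gain[OF j] r by auto
      then show "l r $ j = 0\<^sub>v m $ j" using j by (simp add: l_index)
    qed (simp add: l_def)
  next
    fix x show "l x \<in> carrier_vec m" by (simp add: l_def)
  next
    fix x j assume "j < m" then show "l x $ j \<in> {0, 1}" by (simp add: l_index)
  next
    fix e assume e: "e \<in> parcs tree"
    have "snd e \<noteq> r" using arcD[OF e] root_top by blast
    then obtain k where k: "char_of k < m" "D (snd e) = B k"
      using node_B arcD(2)[OF e] by blast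
    then show "edge_label m l e \<noteq> {}"
      using gain[OF e] loss[OF e] by (cases k) auto
  next
    fix j assume j: "j < m"
    have "card {e \<in> parcs tree. changes l j e} \<le> card {B (Gain j), B (Loss j)}"
    proof (rule card_inj_on_le)
      show "inj_on (D \<circ> snd) {e \<in> parcs tree. changes l j e}"
        by (rule inj_onI) (use D_eq in auto)
      show "(D \<circ> snd) ` {e \<in> parcs tree. changes l j e} \<subseteq> {B (Gain j), B (Loss j)}"
        using changes_at j by auto
    qed simp
    also have "\<dots> \<le> 2" by (simp add: card_insert_if)
    finally show "card {e \<in> parcs tree. changes l j e} \<le> 2" .
  next
    fix j e e'
    assume j: "j < m" and e: "e \<in> parcs tree" "e' \<in> parcs tree"
      and ch: "e \<noteq> e' \<and> changes l j e \<and> changes l j e'"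
    have ends: "(D (snd e) = B (Gain j) \<and> D (snd e') = B (Loss j)) \<or>
        (D (snd e) = B (Loss j) \<and> D (snd e') = B (Gain j))"
      using changes_at[OF e(1) _ j] changes_at[OF e(2) _ j] ch D_eq[OF e] by metis
    have sub: "B (Loss j) \<subset> B (Gain j)"
      using ends strict[OF j] nonempty arcD(2)[OF e(1)] arcD(2)[OF e(2)] by metis
    show "on_common_root_leaf_path tree r e e'"
      using ends
    proof
      assume "D (snd e) = B (Gain j) \<and> D (snd e') = B (Loss j)"
      then show ?thesis using on_common_path[OF e] sub by simp
    next
      assume "D (snd e) = B (Loss j) \<and> D (snd e') = B (Gain j)"
      then have "on_common_root_leaf_path tree r e' e" using on_common_path[OF e(2,1)] sub by simp
      then show ?thesis by (auto simp: on_common_root_leaf_path_def)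
    qed
    assume "closer_to_root tree r e e'"
    then have "D (snd e') \<subset> D (snd e)" by (rule closer_descends)
    then have "D (snd e) = B (Gain j)" "D (snd e') = B (Loss j)"
      using ends sub by auto
    then show "Gain j \<in> edge_label m l e" "Loss j \<in> edge_label m l e'"
      using gain loss e j by auto
  next
    fix i assume i: "i < n"
    show "\<rho> i \<in> pverts tree" using \<rho>[OF i] by (simp add: tree_def)
    show "l (\<rho> i) = row M i"
    proof (rule eq_vecI)
      fix j assume "j < dim_vec (row M i)"
      then have j: "j < m" by (simp add: dims)
      show "l (\<rho> i) $ j = row M i $ j"
        using entries[OF i j] B_M[OF i j] \<rho>_sub[OF i, of "Gain j"] \<rho>_sub[OF i, of "Loss j"] i j
        by (auto simp: l_index dims)
    qed (simp add: l_def dims)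
  qed
  moreover have "consistent E tree r l \<rho>"
    unfolding consistent_def
  proof (clarify)
    fix i j p u v
    assume ij: "(i, j) \<in> E" and p: "tree.awalk r p (\<rho> i)" and e: "(u, v) \<in> set p" "changes l j (u, v)"
    have i: "i < n" and j: "j < m" using cm ij by (auto simp: constrained_matrix_def)
    obtain p1 p2 where "p = p1 @ (u, v) # p2" using e(1) by (meson split_list)
    then have "tree.awalk v p2 (\<rho> i)" and arc: "(u, v) \<in> parcs tree"
      using p by (auto simp: tree.awalk_simps)
    then have "i \<in> D v" using walk_descends(1) \<rho>[OF i] by blast
    then have "i \<in> B (Gain j)"
      using changes_at[OF arc e(2) j] B_Loss[OF j] by auto
    then show False using B ij unfolding laminar_extension_def by blast
  qed
  ultimately show ?thesis
    unfolding admits_persistent_phylogeny_def by blast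
qed

section \<open>Red-black graphs under realization\<close>

definition reach :: "red_black \<Rightarrow> (vertex \<times> vertex) set" where
  "reach G = rtrancl_on (pverts (graph_of G)) (parcs (graph_of G))"

lemma component_species_eq: "component_species G c = {s. (Character c, Species s) \<in> reach G}"
  by (simp add: component_species_def reach_def reachable_def)

lemma reach_sym: "(x, y) \<in> reach G \<Longrightarrow> (y, x) \<in> reach G"
proof -
  have "sym (parcs (graph_of G))"
    by (auto simp: sym_def graph_of_def)
  then show "(x, y) \<in> reach G \<Longrightarrow> (y, x) \<in> reach G"
    unfolding reach_def by (meson rtrancl_on_sym symD)
qed

lemma reach_trans: "(x, y) \<in> reach G \<Longrightarrow> (y, z) \<in> reach G \<Longrightarrow> (x, z) \<in> reach G"
  unfolding reach_def by (rule rtrancl_on_trans)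

lemma component_species_bounds:
  assumes "s \<in> component_species G c"
  shows "s < dim_row (ext_mat G)" "c < dim_col (ext_mat G) div 2"
  using assms in_rtrancl_on_in_F[of "Character c" "Species s"]
  unfolding component_species_eq reach_def by (fastforce simp: graph_of_def)+

lemma adjacent_in_component_species:
  assumes "(s, c) \<in> black G \<union> red G" "s < dim_row (ext_mat G)" "c < dim_col (ext_mat G) div 2"
  shows "s \<in> component_species G c"
  unfolding component_species_eq reach_def
  using assms by (auto intro!: rtrancl_on_into_rtrancl_on[of "Character c" "Character c"] simp: graph_of_def)

lemma reach_realize:
  "reach (realize G k) \<subseteq> reach G"
proof -
  have verts: "pverts (graph_of (realize G k)) = pverts (graph_of G)"
    by (cases k) (simp_all add: graph_of_def Let_def set_pair_def)
  have edge: "(Character c, Species s) \<in> reach G"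
    if "(s, c) \<in> black (realize G k) \<union> red (realize G k)"
      and "Species s \<in> pverts (graph_of G)" "Character c \<in> pverts (graph_of G)" for s c
  proof (cases "(s, c) \<in> black G \<union> red G")
    case True
    then show ?thesis
      using that adjacent_in_component_species[of s c G]
      by (auto simp: component_species_eq graph_of_def)
  next
    case False
    then show ?thesis using that
      by (cases k) (auto simp: Let_def component_species_eq)
  qed
  have step: "(y, z) \<in> reach G"
    if "(y, z) \<in> parcs (graph_of (realize G k))"
      and "y \<in> pverts (graph_of G)" "z \<in> pverts (graph_of G)" for y z
  proof -
    from that(1) consider s c where "y = Species s" "z = Character c"
        "(s, c) \<in> black (realize G k) \<union> red (realize G k)"
      | s c where "y = Character c" "z = Species s"
        "(s, c) \<in> black (realize G k) \<union> red (realize G k)"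
      unfolding graph_of_def by auto
    then show ?thesis
      using that edge by cases (blast intro: reach_sym)+
  qed
  show ?thesis
  proof (rule subrelI)
    fix x y
    assume "(x, y) \<in> reach (realize G k)"
    then show "(x, y) \<in> reach G"
      unfolding reach_def[of "realize G k"] verts
    proof (induction rule: rtrancl_on_induct)
      case base
      then show ?case by (simp add: reach_def)
    next
      case (step y z)
      then show ?case using \<open>\<And>y z. _ \<Longrightarrow> _ \<Longrightarrow> _ \<Longrightarrow> (y, z) \<in> reach G\<close> reach_trans by blast
    qed
  qed
qed

lemma component_species_realize: "component_species (realize G k) c \<subseteq> component_species G c"
  using reach_realize[of G k] by (auto simp: component_species_eq)

definition rb_invariant :: "entry mat \<Rightarrow> red_black \<Rightarrow> bool" where
  "rb_invariant A G \<longleftrightarrow>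
     dim_row (ext_mat G) = dim_row A \<and> dim_col (ext_mat G) = dim_col A \<and>
     black G \<subseteq> black (initial_red_black A) \<and>
     red G \<subseteq> {..<dim_row A} \<times> {..<dim_col A div 2} - black (initial_red_black A) \<and>
     (\<forall>c. status_of G c = Inactive \<longrightarrow>
        (\<forall>s. (s, c) \<in> black (initial_red_black A) \<longrightarrow> (s, c) \<in> black G) \<and>
        (\<forall>s < dim_row A. c < dim_col A div 2 \<longrightarrow>
           ext_mat G $$ (s, 2 * c) = A $$ (s, 2 * c) \<and>
           ext_mat G $$ (s, 2 * c + 1) = A $$ (s, 2 * c + 1)))"

lemma rb_invariant_initial: "rb_invariant A (initial_red_black A)"
  by (simp add: rb_invariant_def initial_red_black_def)

lemma rb_invariant_bounds:
  assumes "rb_invariant A G" "(s, c) \<in> black G \<union> red G"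
  shows "s < dim_row (ext_mat G)" "c < dim_col (ext_mat G) div 2"
  using assms by (auto simp: rb_invariant_def initial_red_black_def)

lemma rb_invariant_adjacent:
  assumes "rb_invariant A G" "(s, c) \<in> black G \<union> red G"
  shows "s \<in> component_species G c"
  using adjacent_in_component_species rb_invariant_bounds assms by blast

lemma rb_invariant_realize:
  assumes inv: "rb_invariant A G" and poss: "possible G k"
  shows "rb_invariant A (realize G k)"
proof (cases k)
  case (Gain c)
  have red: "s < dim_row A \<and> c < dim_col A div 2 \<and> (s, c) \<notin> black (initial_red_black A)"
    if "s \<in> component_species G c" "(s, c) \<notin> black G" for s
    using that component_species_bounds[OF that(1)] inv poss Gain
    by (auto simp: rb_invariant_def)
  have mat: "set_pair (ext_mat G) c f $$ (s, 2 * c') = ext_mat G $$ (s, 2 * c')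
      \<and> set_pair (ext_mat G) c f $$ (s, 2 * c' + 1) = ext_mat G $$ (s, 2 * c' + 1)"
    if "c' \<noteq> c" "s < dim_row A" "c' < dim_col A div 2" for f s c'
  proof -
    have "2 * c' \<noteq> Suc (2 * c)" "Suc (2 * c') \<noteq> 2 * c" "Suc (2 * c') < dim_col A"
      using that(3) by presburger+
    then show ?thesis
      using that inv by (auto simp: set_pair_def rb_invariant_def)
  qed
  show ?thesis
    unfolding rb_invariant_def
  proof (intro conjI allI impI)
    show "red (realize G k)
        \<subseteq> {..<dim_row A} \<times> {..<dim_col A div 2} - black (initial_red_black A)"
      using inv red Gain by (auto simp: rb_invariant_def Let_def)
  qed (use inv Gain mat in \<open>auto simp: rb_invariant_def Let_def set_pair_def split: if_splits\<close>)
next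
  case (Loss c)
  then show ?thesis using inv by (auto simp: rb_invariant_def)
qed

context
  fixes n m :: nat and M :: "nat mat" and E :: "(nat \<times> nat) set"
  assumes cm: "constrained_matrix n m M E"
begin

lemma dim_extended: "dim_row (extended_matrix M E) = n" "dim_col (extended_matrix M E) = 2 * m"
  using cm by (auto simp: extended_matrix_def constrained_matrix_def)

lemma black_initial:
  "black (initial_red_black (extended_matrix M E)) = {(s, c). s < n \<and> c < m \<and> M $$ (s, c) = 1}"
proof -
  have "dim_row M = n" "dim_col M = m"
    using cm by (auto simp: constrained_matrix_def)
  then show ?thesis
    by (auto simp: initial_red_black_def extended_matrix_def split: if_splits)
qed

lemma extended_zero_iff:
  assumes "s < n" "c < m"
  shows "extended_matrix M E $$ (s, 2 * c) = Zero \<and> extended_matrix M E $$ (s, 2 * c + 1) = Zero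
    \<longleftrightarrow> (s, c) \<in> E"
  using cm assms by (auto simp: constrained_matrix_def extended_matrix_def split: if_splits)

lemma possible_Gain_iff:
  assumes "rb_invariant (extended_matrix M E) G"
  shows "possible G (Gain c) \<longleftrightarrow>
    status_of G c = Inactive \<and> (\<forall>s \<in> component_species G c. (s, c) \<notin> E)"
proof -
  have "ext_mat G $$ (s, 2 * c) = Zero \<and> ext_mat G $$ (s, 2 * c + 1) = Zero \<longleftrightarrow> (s, c) \<in> E"
    if "status_of G c = Inactive" "s \<in> component_species G c" for s
    using that component_species_bounds[OF that(2)] extended_zero_iff[of s c] assms
    by (simp add: rb_invariant_def dim_extended)
  then show ?thesis by auto
qed

section \<open>From reductions to laminar families\<close>

lemma laminar_extension_if_reduction:
  assumes R: "successful_c_reduction (initial_red_black (extended_matrix M E)) R"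
  shows "\<exists>B. laminar_extension n m M E B"
proof -
  define H where "H i = foldl realize (initial_red_black (extended_matrix M E)) (take i R)" for i
  have H_Suc: "H (Suc i) = realize (H i) (R ! i)" if "i < length R" for i
    using that by (simp add: H_def take_Suc_conv_app_nth)
  have all_poss: "possible (H i) (R ! i)" if "i < length R" for i
  proof -
    have "all_possible G xs \<Longrightarrow> i < length xs \<Longrightarrow> possible (foldl realize G (take i xs)) (xs ! i)"
      for G xs
      by (induction xs arbitrary: G i) (auto simp: nth_Cons' take_Cons')
    then show ?thesis
      using R that by (auto simp: successful_c_reduction_def H_def)
  qed
  have inv: "rb_invariant (extended_matrix M E) (H i)" if "i \<le> length R" for i
    using that
  proof (induction i)
    case 0
    then show ?case by (simp add: H_def rb_invariant_initial)
  next
    case (Suc i)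
    then show ?case
      using H_Suc all_poss rb_invariant_realize by simp
  qed
  have mono: "reach (H j) \<subseteq> reach (H i)" if "i \<le> j" "j \<le> length R" for i j
    using that
  proof (induction j rule: dec_induct)
    case (step j)
    then show ?case using reach_realize[of "H j" "R ! j"] H_Suc by auto
  qed simp
  have red_stays: "(s, c) \<in> red (H j)"
    if "(s, c) \<in> red (H i)" "i \<le> j" "j \<le> length R" "\<And>l. i \<le> l \<Longrightarrow> l < j \<Longrightarrow> R ! l \<noteq> Loss c"
    for s c i j
    using that(2,3,4)
  proof (induction j rule: dec_induct)
    case base
    show ?case by fact
  next
    case (step j)
    then have "(s, c) \<in> red (H j)" "R ! j \<noteq> Loss c" by auto
    then show ?case
      using step.hyps step.prems by (cases "R ! j") (auto simp: H_Suc Let_def)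
  qed
  define first where "first k = (LEAST i. i < length R \<and> R ! i = k)" for k
  have first: "first k < length R" "R ! first k = k" if "k \<in> set R" for k
    using that LeastI_ex[of "\<lambda>i. i < length R \<and> R ! i = k"]
    by (auto simp: first_def in_set_conv_nth)
  have first_le: "first k \<le> i" if "i < length R" "R ! i = k" for i k
    using that unfolding first_def by (intro Least_le) simp
  have chars: "char_of ` set R \<subseteq> {..<m}" "\<And>c. c < m \<Longrightarrow> Gain c \<in> set R"
    and order: "\<And>i c. i < length R \<Longrightarrow> R ! i = Loss c \<Longrightarrow> \<exists>j < i. R ! j = Gain c"
    and final: "red (H (length R)) = {}"
    using R by (auto simp: successful_c_reduction_def initial_red_black_def dim_extended H_def)
  have first_less: "first (Gain c) < first (Loss c)" if "Loss c \<in> set R" for c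
  proof -
    have L: "first (Loss c) < length R" "R ! first (Loss c) = Loss c"
      using that by (rule first)+
    obtain j where j: "j < first (Loss c)" "R ! j = Gain c"
      using order[OF L] by blast
    then have "first (Gain c) \<le> j"
      using L(1) by (intro first_le) auto
    then show ?thesis using j by simp
  qed
  define B where "B k = (if k \<in> set R then component_species (H (first k)) (char_of k) else {})" for k
  have nested: "B k' \<subseteq> B k \<or> B k \<inter> B k' = {}"
    if "k \<in> set R" "k' \<in> set R" "first k \<le> first k'" for k k'
  proof (cases "B k \<inter> B k' = {}")
    case False
    then obtain s where s: "s \<in> B k" "s \<in> B k'" by auto
    have "B k' \<subseteq> B k"
    proof
      fix t
      assume "t \<in> B k'"
      then have "(Species s, Species t) \<in> reach (H (first k'))"
        using s that by (auto simp: B_def component_species_eq intro: reach_sym reach_trans)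
      then have "(Species s, Species t) \<in> reach (H (first k))"
        using mono[OF that(3)] first[OF that(2)] by auto
      then show "t \<in> B k"
        using s that by (auto simp: B_def component_species_eq intro: reach_trans)
    qed
    then show ?thesis ..
  qed simp
  have "laminar_extension n m M E B"
    unfolding laminar_extension_def
  proof (intro conjI allI impI)
    fix c assume c: "c < m"
    show "B (Loss c) \<subseteq> B (Gain c)"
    proof (cases "Loss c \<in> set R")
      case True
      then have "reach (H (first (Loss c))) \<subseteq> reach (H (first (Gain c)))"
        using mono first_less[OF True] first[OF True] by auto
      then show ?thesis
        using True chars(2)[OF c] by (auto simp: B_def component_species_eq)
    qed (simp add: B_def)
    show "B (Gain c) \<subseteq> {..<n}"
    proof
      fix s
      assume "s \<in> B (Gain c)"
      then have "s \<in> component_species (H (first (Gain c))) c"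
        using chars(2)[OF c] by (simp add: B_def)
      then show "s \<in> {..<n}"
        using component_species_bounds(1) inv[of "first (Gain c)"] first[OF chars(2)[OF c]]
        by (force simp: rb_invariant_def dim_extended)
    qed
  next
    fix s c assume s: "s < n" and c: "c < m"
    let ?i = "first (Gain c)"
    have i: "?i < length R" "R ! ?i = Gain c"
      using chars(2)[OF c] first by auto
    have inactive: "status_of (H ?i) c = Inactive"
      using all_poss[OF i(1)] i(2) by simp
    have inv_i: "rb_invariant (extended_matrix M E) (H ?i)"
      using inv i by simp
    have BG: "B (Gain c) = component_species (H ?i) c"
      using chars(2)[OF c] by (simp add: B_def)
    show "M $$ (s, c) = 1 \<longleftrightarrow> s \<in> B (Gain c) - B (Loss c)"
    proof
      assume one: "M $$ (s, c) = 1"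
      then have "(s, c) \<in> black (H ?i)"
        using inv_i inactive s c by (auto simp: rb_invariant_def black_initial)
      then have "s \<in> B (Gain c)"
        using BG rb_invariant_adjacent[OF inv_i] by auto
      moreover have "s \<notin> B (Loss c)"
      proof
        assume s_loss: "s \<in> B (Loss c)"
        then have loss: "Loss c \<in> set R"
          by (auto simp: B_def split: if_splits)
        then have "(s, c) \<in> red (H (first (Loss c)))"
          using all_poss[of "first (Loss c)"] first[OF loss] s_loss by (auto simp: B_def)
        then show False
          using inv[of "first (Loss c)"] first[OF loss] one s c
          by (auto simp: rb_invariant_def black_initial)
      qed
      ultimately show "s \<in> B (Gain c) - B (Loss c)" by simp
    next
      assume in_diff: "s \<in> B (Gain c) - B (Loss c)"
      show "M $$ (s, c) = 1"
      proof (rule ccontr)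
        assume "M $$ (s, c) \<noteq> 1"
        then have "(s, c) \<notin> black (H ?i)"
          using inv_i by (auto simp: rb_invariant_def black_initial)
        then have red: "(s, c) \<in> red (H (Suc ?i))"
          using in_diff i by (auto simp: H_Suc BG Let_def)
        have loss: "Loss c \<in> set R"
        proof (rule ccontr)
          assume "Loss c \<notin> set R"
          then have "R ! l \<noteq> Loss c" if "l < length R" for l
            using that by (metis nth_mem)
          then have "(s, c) \<in> red (H (length R))"
            using i by (intro red_stays[OF red]) auto
          then show False using final by simp
        qed
        have "(s, c) \<in> red (H (first (Loss c)))"
        proof (rule red_stays[OF red])
          show "Suc ?i \<le> first (Loss c)" using first_less[OF loss] by simp
          show "first (Loss c) \<le> length R" using first(1)[OF loss] by simp
          show "R ! l \<noteq> Loss c" if "l < first (Loss c)" for l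
            using first_le[of l "Loss c"] first(1)[OF loss] that by auto
        qed
        then have "s \<in> B (Loss c)"
          using rb_invariant_adjacent[OF inv] first[OF loss] loss by (simp add: B_def)
        then show False using in_diff by simp
      qed
    qed
  next
    show "\<forall>(s, c) \<in> E. s \<notin> B (Gain c)"
    proof (intro ballI, clarify)
      fix s c
      assume sc: "(s, c) \<in> E" "s \<in> B (Gain c)"
      then have gain: "Gain c \<in> set R" "s \<in> component_species (H (first (Gain c))) c"
        by (auto simp: B_def split: if_splits)
      have "possible (H (first (Gain c))) (Gain c)"
        using all_poss first[OF gain(1)] by metis
      then show False
        using possible_Gain_iff[OF inv[of "first (Gain c)"]] first(1)[OF gain(1)] gain(2) sc(1) by auto
    qed
  next
    fix k k'
    show "B k \<subseteq> B k' \<or> B k' \<subseteq> B k \<or> B k \<inter> B k' = {}"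
    proof (cases "k \<in> set R \<and> k' \<in> set R")
      case True
      then show ?thesis
        using nested[of k k'] nested[of k' k] linorder_le_cases[of "first k" "first k'"] by blast
    qed (auto simp: B_def)
  qed
  then show ?thesis by blast
qed

section \<open>From laminar families to reductions\<close>

text \<open>\<open>U\<close> is the set of signed characters that are still to be realized. Each edge of the graph
  at \<open>c\<close> has a species that lies in the set of the next signed character of \<open>c\<close>.\<close>

definition pending_invariant ::
    "(signed_char \<Rightarrow> nat set) \<Rightarrow> signed_char set \<Rightarrow> red_black \<Rightarrow> bool" where
  "pending_invariant B U G \<longleftrightarrow>
     rb_invariant (extended_matrix M E) G \<and>
     (\<forall>(s, c) \<in> black G. Gain c \<in> U) \<and>
     (\<forall>(s, c) \<in> red G. Gain c \<notin> U \<and> Loss c \<in> U \<and> s \<in> B (Loss c)) \<and>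
     (\<forall>c. Gain c \<in> U \<longrightarrow> Loss c \<in> U \<and> status_of G c = Inactive) \<and>
     (\<forall>c. Gain c \<notin> U \<and> Loss c \<in> U \<longrightarrow> status_of G c = Active \<and>
        (\<forall>s \<in> component_species G c. M $$ (s, c) \<noteq> 1 \<longrightarrow> (s, c) \<in> red G))"

lemma component_in_next_set:
  assumes B: "laminar_extension n m M E B" and G: "pending_invariant B U G"
    and k: "k \<in> U" "\<And>c. k = Loss c \<Longrightarrow> Gain c \<notin> U"
    and first: "\<And>k'. k' \<in> U \<Longrightarrow> B k' \<subseteq> B k \<or> B k \<inter> B k' = {}"
  shows "component_species G (char_of k) \<subseteq> B k"
proof -
  define next_of where "next_of c = (if Gain c \<in> U then Gain c else Loss c)" for c
  have edge: "s \<in> B (next_of c) \<and> next_of c \<in> U" if sc: "(s, c) \<in> black G \<union> red G" for s c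
  proof (cases "(s, c) \<in> black G")
    case True
    then have "s < n \<and> c < m \<and> M $$ (s, c) = 1"
      using G by (auto simp: pending_invariant_def rb_invariant_def black_initial)
    then have "s \<in> B (Gain c)"
      using B unfolding laminar_extension_def by blast
    then show ?thesis
      using True G by (auto simp: pending_invariant_def next_of_def)
  next
    case False
    then show ?thesis
      using sc G by (auto simp: pending_invariant_def next_of_def)
  qed
  define Q where "Q x = (case x of Species s \<Rightarrow> s \<in> B k | Character c \<Rightarrow> B (next_of c) \<subseteq> B k)" for x
  have "Q y" if "(Character (char_of k), y) \<in> reach G" for y
    using that unfolding reach_def
  proof (induction rule: rtrancl_on_induct)
    case base
    have "next_of (char_of k) = k"
      using k by (cases k) (auto simp: next_of_def)
    then show ?case by (simp add: Q_def)
  next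
    case (step y z)
    from step.hyps(2) consider s c where "y = Species s" "z = Character c" "(s, c) \<in> black G \<union> red G"
      | s c where "y = Character c" "z = Species s" "(s, c) \<in> black G \<union> red G"
      unfolding graph_of_def by auto
    then show ?case
    proof cases
      case 1
      then show ?thesis
        using step.IH edge[OF 1(3)] first[of "next_of c"] by (auto simp: Q_def)
    next
      case 2
      then show ?thesis
        using step.IH edge[OF 2(3)] by (auto simp: Q_def)
    qed
  qed
  then show ?thesis
    by (fastforce simp: component_species_eq Q_def)
qed

lemma pending_invariant_step:
  assumes B: "laminar_extension n m M E B" and G: "pending_invariant B U G"
    and k: "k \<in> U" "\<And>c. k = Loss c \<Longrightarrow> Gain c \<notin> U"
    and first: "\<And>k'. k' \<in> U \<Longrightarrow> B k' \<subseteq> B k \<or> B k \<inter> B k' = {}"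
  shows "possible G k \<and> pending_invariant B (U - {k}) (realize G k)"
proof -
  note comp = component_in_next_set[OF assms]
  have inv: "rb_invariant (extended_matrix M E) G"
    using G by (simp add: pending_invariant_def)
  have active: "\<And>c s. Gain c \<notin> U \<Longrightarrow> Loss c \<in> U \<Longrightarrow> s \<in> component_species G c
      \<Longrightarrow> M $$ (s, c) \<noteq> 1 \<Longrightarrow> (s, c) \<in> red G"
    using G by (auto simp: pending_invariant_def)
  have bounds: "s < n \<and> c < m" if "s \<in> component_species G c" for s c
    using component_species_bounds[OF that] inv by (simp add: rb_invariant_def dim_extended)
  have shrink: "s \<in> component_species G c" if "s \<in> component_species (realize G k) c" for s c
    using that component_species_realize by blast
  show ?thesis
  proof (cases k)
    case (Gain c)
    have inactive: "status_of G c = Inactive" and loss: "Loss c \<in> U"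
      using G k Gain by (auto simp: pending_invariant_def)
    have "possible G k"
      using B comp inactive unfolding Gain possible_Gain_iff[OF inv] laminar_extension_def by auto
    have black: "(s, c) \<in> black G \<longleftrightarrow> M $$ (s, c) = 1" if "s \<in> component_species G c" for s
      using bounds[OF that] inv inactive by (auto simp: rb_invariant_def black_initial)
    have no_red: "(s, c) \<notin> red G" for s
      using G k Gain by (auto simp: pending_invariant_def)
    have new_red: "s \<in> B (Loss c)" if "s \<in> component_species G c" "(s, c) \<notin> black G" for s
      using that black[OF that(1)] bounds[OF that(1)] comp Gain B
      unfolding laminar_extension_def by auto
    have "pending_invariant B (U - {k}) (realize G k)"
      unfolding pending_invariant_def
    proof (intro conjI)
      show "rb_invariant (extended_matrix M E) (realize G k)"
        using rb_invariant_realize[OF inv \<open>possible G k\<close>] .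
      show "\<forall>(s, c) \<in> black (realize G k). Gain c \<in> U - {k}"
        using G Gain by (auto simp: pending_invariant_def Let_def)
      show "\<forall>(s, c) \<in> red (realize G k). Gain c \<notin> U - {k} \<and> Loss c \<in> U - {k} \<and> s \<in> B (Loss c)"
      proof (intro ballI, clarify)
        fix s d
        assume "(s, d) \<in> red (realize G k)"
        then consider "(s, d) \<in> red G" | "d = c" "s \<in> component_species G c" "(s, c) \<notin> black G"
          using Gain by (auto simp: Let_def)
        then show "Gain d \<notin> U - {k} \<and> Loss d \<in> U - {k} \<and> s \<in> B (Loss d)"
        proof cases
          case 1
          then show ?thesis using G Gain by (auto simp: pending_invariant_def)
        next
          case 2
          then show ?thesis using new_red loss Gain by simp
        qed
      qed
      show "\<forall>c. Gain c \<in> U - {k} \<longrightarrow> Loss c \<in> U - {k} \<and> status_of (realize G k) c = Inactive"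
        using G Gain by (auto simp: pending_invariant_def Let_def)
      show "\<forall>c. Gain c \<notin> U - {k} \<and> Loss c \<in> U - {k} \<longrightarrow> status_of (realize G k) c = Active \<and>
          (\<forall>s \<in> component_species (realize G k) c. M $$ (s, c) \<noteq> 1 \<longrightarrow> (s, c) \<in> red (realize G k))"
      proof (intro allI impI conjI ballI)
        fix d s
        assume d: "Gain d \<notin> U - {k} \<and> Loss d \<in> U - {k}"
        show "status_of (realize G k) d = Active"
          using d G Gain by (auto simp: pending_invariant_def Let_def)
        assume s: "s \<in> component_species (realize G k) d" "M $$ (s, d) \<noteq> 1"
        note s' = shrink[OF s(1)]
        show "(s, d) \<in> red (realize G k)"
        proof (cases "d = c")
          case True
          then show ?thesis using s' s(2) black no_red by (simp add: Gain Let_def)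
        next
          case False
          then have "(s, d) \<in> red G" using active[OF _ _ s' s(2)] d Gain by simp
          then show ?thesis by (simp add: Gain Let_def)
        qed
      qed
    qed
    with \<open>possible G k\<close> show ?thesis ..
  next
    case (Loss c)
    have gain: "Gain c \<notin> U" using k Loss by simp
    have red: "(s, c) \<in> red G" if "s \<in> component_species G c" for s
    proof (rule active[OF gain _ that])
      show "Loss c \<in> U" using k Loss by simp
      show "M $$ (s, c) \<noteq> 1"
        using bounds[OF that] that comp Loss B unfolding laminar_extension_def by auto
    qed
    have "possible G k"
      using red G gain k Loss by (auto simp: pending_invariant_def)
    have no_red: "s \<in> component_species G c" if "(s, c) \<in> red G" for s
      using that rb_invariant_adjacent[OF inv] by auto
    have "pending_invariant B (U - {k}) (realize G k)"
      unfolding pending_invariant_def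
    proof (intro conjI)
      show "rb_invariant (extended_matrix M E) (realize G k)"
        using rb_invariant_realize[OF inv \<open>possible G k\<close>] .
      show "\<forall>(s, c) \<in> black (realize G k). Gain c \<in> U - {k}"
        using G Loss by (auto simp: pending_invariant_def)
      show "\<forall>(s, c) \<in> red (realize G k). Gain c \<notin> U - {k} \<and> Loss c \<in> U - {k} \<and> s \<in> B (Loss c)"
      proof (intro ballI, clarify)
        fix s d
        assume sd: "(s, d) \<in> red (realize G k)"
        then have "d \<noteq> c" using Loss no_red by auto
        moreover have "(s, d) \<in> red G" using sd Loss by simp
        ultimately show "Gain d \<notin> U - {k} \<and> Loss d \<in> U - {k} \<and> s \<in> B (Loss d)"
          using G Loss by (auto simp: pending_invariant_def)
      qed
      show "\<forall>c. Gain c \<in> U - {k} \<longrightarrow> Loss c \<in> U - {k} \<and> status_of (realize G k) c = Inactive"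
        using G Loss gain by (auto simp: pending_invariant_def)
      show "\<forall>c. Gain c \<notin> U - {k} \<and> Loss c \<in> U - {k} \<longrightarrow> status_of (realize G k) c = Active \<and>
          (\<forall>s \<in> component_species (realize G k) c. M $$ (s, c) \<noteq> 1 \<longrightarrow> (s, c) \<in> red (realize G k))"
      proof (intro allI impI conjI ballI)
        fix d s
        assume d: "Gain d \<notin> U - {k} \<and> Loss d \<in> U - {k}"
        show "status_of (realize G k) d = Active"
          using d G Loss by (auto simp: pending_invariant_def)
        assume s: "s \<in> component_species (realize G k) d" "M $$ (s, d) \<noteq> 1"
        have "(s, d) \<in> red G"
          using active[OF _ _ shrink[OF s(1)] s(2)] d Loss by simp
        then show "(s, d) \<in> red (realize G k)" using d Loss by simp
      qed
    qed
    with \<open>possible G k\<close> show ?thesis ..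
  qed
qed

lemma reduction_by_sorted_list:
  assumes B: "laminar_extension n m M E B" and "pending_invariant B (set R) G" "distinct R"
    and "sorted_wrt (\<lambda>k k'. (B k' \<subseteq> B k \<or> B k \<inter> B k' = {}) \<and> (\<forall>c. k = Loss c \<longrightarrow> k' \<noteq> Gain c)) R"
  shows "all_possible G R \<and> black (foldl realize G R) = {} \<and> red (foldl realize G R) = {}"
  using assms(2-)
proof (induction R arbitrary: G)
  case Nil
  then show ?case by (auto simp: pending_invariant_def)
next
  case (Cons k R)
  have "possible G k \<and> pending_invariant B (set (k # R) - {k}) (realize G k)"
    using Cons.prems by (intro pending_invariant_step[OF B]) auto
  moreover have "set (k # R) - {k} = set R"
    using Cons.prems by auto
  ultimately show ?case
    using Cons by auto
qed

lemma reduction_if_laminar_extension: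
  assumes B: "laminar_extension n m M E B"
  shows "\<exists>R. successful_c_reduction (initial_red_black (extended_matrix M E)) R"
proof -
  define key where
    "key k = 2 * (n - card (B k)) + (case k of Gain _ \<Rightarrow> 0 | Loss _ \<Rightarrow> 1)" for k :: signed_char
  define R where "R = sort_key key (map Gain [0..<m] @ map Loss [0..<m])"
  have set_R: "set R = Gain ` {..<m} \<union> Loss ` {..<m}"
    by (auto simp: R_def)
  have "distinct R"
    by (auto simp: R_def distinct_map inj_on_def)
  have B_le: "B k \<subseteq> {..<n}" if "k \<in> set R" for k
    using that B unfolding set_R laminar_extension_def by auto
  have order: "(B k' \<subseteq> B k \<or> B k \<inter> B k' = {}) \<and> (\<forall>c. k = Loss c \<longrightarrow> k' \<noteq> Gain c)"
    if kk: "k \<in> set R" "k' \<in> set R" "key k \<le> key k'" for k k'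
  proof (intro conjI allI impI)
    have card: "card (B k) \<le> n" "card (B k') \<le> n" "finite (B k)" "finite (B k')"
      using B_le[OF kk(1)] B_le[OF kk(2)] subset_eq_atLeast0_lessThan_card
      by (auto simp: lessThan_atLeast0 intro: finite_subset)
    then have card_le: "card (B k') \<le> card (B k)"
      using kk(3) by (auto simp: key_def split: signed_char.splits)
    have "char_of k < m" "char_of k' < m"
      using kk set_R by auto
    then have "B k \<subseteq> B k' \<or> B k' \<subseteq> B k \<or> B k \<inter> B k' = {}"
      using B unfolding laminar_extension_def by blast
    then show "B k' \<subseteq> B k \<or> B k \<inter> B k' = {}"
      using card_le card card_seteq by blast
    fix c
    assume "k = Loss c"
    then have "c < m" using kk set_R by auto
    then have "B (Loss c) \<subseteq> B (Gain c)" "finite (B (Gain c))"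
      using B unfolding laminar_extension_def by (auto intro: finite_subset)
    then have "card (B (Loss c)) \<le> card (B (Gain c))"
      by (rule card_mono[rotated])
    then show "k' \<noteq> Gain c"
      using kk(3) \<open>k = Loss c\<close> by (auto simp: key_def)
  qed
  have sorted: "sorted_wrt
      (\<lambda>k k'. (B k' \<subseteq> B k \<or> B k \<inter> B k' = {}) \<and> (\<forall>c. k = Loss c \<longrightarrow> k' \<noteq> Gain c)) R"
    (is "sorted_wrt ?P R")
  proof -
    have "sorted (map key R)" by (simp add: R_def)
    then have "sorted_wrt (\<lambda>k k'. key k \<le> key k') R" by (simp add: sorted_wrt_map)
    then show ?thesis
      by (rule sorted_wrt_mono_rel[rotated]) (rule order)
  qed
  have "pending_invariant B (set R) (initial_red_black (extended_matrix M E))"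
    unfolding pending_invariant_def set_R
    using rb_invariant_initial
    by (auto simp: black_initial) (auto simp: initial_red_black_def)
  note red = reduction_by_sorted_list[OF B this \<open>distinct R\<close> sorted]
  have "\<exists>i < k. R ! i = Gain c" if k: "k < length R" "R ! k = Loss c" for k c
  proof -
    have "Loss c \<in> set R" using k by (metis nth_mem)
    then have "Gain c \<in> set R" using set_R by auto
    then obtain i where i: "i < length R" "R ! i = Gain c"
      by (auto simp: in_set_conv_nth)
    have "\<not> k < i"
      using sorted_wrt_nth_less[OF sorted, of k i] i k by auto
    moreover have "i \<noteq> k" using i k by auto
    ultimately show ?thesis using i by (intro exI[of _ i]) auto
  qed
  then have "successful_c_reduction (initial_red_black (extended_matrix M E)) R"
    using red unfolding successful_c_reduction_def
    by (auto simp: set_R initial_red_black_def dim_extended)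
  then show ?thesis by blast
qed

end

section \<open>The equivalence\<close>

theorem theorem2:
  fixes n m :: nat and M :: "nat mat" and E :: "(nat \<times> nat) set"
  assumes "constrained_matrix n m M E"
  shows "admits_persistent_phylogeny M E \<longleftrightarrow>
    (\<exists>R. successful_c_reduction (initial_red_black (extended_matrix M E)) R)"
proof
  assume "admits_persistent_phylogeny M E"
  then obtain B where "laminar_extension n m M E B"
    unfolding admits_persistent_phylogeny_def
    using laminar_extension_if_phylogeny[OF assms] by metis
  then show "\<exists>R. successful_c_reduction (initial_red_black (extended_matrix M E)) R"
    by (rule reduction_if_laminar_extension[OF assms])
next
  assume "\<exists>R. successful_c_reduction (initial_red_black (extended_matrix M E)) R"
  then obtain R where "successful_c_reduction (initial_red_black (extended_matrix M E)) R" ..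
  from laminar_extension_if_reduction[OF assms this]
  obtain B where "laminar_extension n m M E B" ..
  then show "admits_persistent_phylogeny M E"
    by (rule phylogeny_if_laminar_extension[OF assms])
qed

end
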